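(* Let $G$ be a finite, simple, connected graph with at least one edge, on vertex set $\{1,\dots,N\}$, and let $\nabla_G=\{\pm(\mathbf e_i-\mathbf e_j)\mid \{i,j\}\in\mathcal E(G)\}\subset\mathbb R^N$. (1) A connected subgraph $H$ of $G$ with at least one edge is a face subgraph of $G$ (i.e. $H=G_F$ for some nonempty proper face $F$ of $\nabla_G$) if and only if $H$ is a maximal bipartite subgraph of the induced subgraph $G[\mathcal V(H)]$. (2) A subgraph $H$ of $G$ is a facet subgraph of $G$ (i.e. $H=G_F$ for some facet $F$ of $\nabla_G$) if and only if $H$ is a maximal bipartite subgraph of $G$.
   Context: $\mathbf e_1,\dots,\mathbf e_N$ is the standard basis of $\mathbb R^N$; $\operatorname{conv}(\nabla_G)$ is the adjacency polytope (symmetric edge polytope) of $G$. A subset $F\subseteq\nabla_G$ is a face (resp. facet) of $\nabla_G$ if $F=\nabla_G\cap P'$ for a face (resp. facet) $P'$ of the polytope $\operatorname{conv}(\nabla_G)$; a nonempty face is the set of points of $\nabla_G$ at which some linear functional $\langle\cdot,\boldsymbol\alpha\rangle$ attains its minimum over $\nabla_G$. For a nonempty $X\subseteq\nabla_G$, $G_X$ is the undirected graph whose edges are the $\{i,j\}$ with $\mathbf e_i-\mathbf e_j\in X$ or $\mathbf e_j-\mathbf e_i\in X$, and whose vertices are the endpoints of these edges. A maximal bipartite subgraph of a graph is a bipartite subgraph that is maximal under inclusion among bipartite subgraphs. For $V\subseteq\mathcal V(G)$, $G[V]$ is the induced subgraph on $V$. *)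

theory Defs
  imports "HOL-Analysis.Analysis"
begin

text \<open>A graph is a pair of a vertex set and a set of undirected edges, an edge being the set of its
  two endpoints.\<close>

type_synonym 'a ugraph = "'a set \<times> 'a set set"

abbreviation verts :: "'a ugraph \<Rightarrow> 'a set" where
  "verts G \<equiv> fst G"

abbreviation edges :: "'a ugraph \<Rightarrow> 'a set set" where
  "edges G \<equiv> snd G"

definition simple_graph :: "'a ugraph \<Rightarrow> bool" where
  "simple_graph G \<longleftrightarrow> (\<forall>e\<in>edges G. e \<subseteq> verts G \<and> card e = 2)"

definition subgraph :: "'a ugraph \<Rightarrow> 'a ugraph \<Rightarrow> bool" where
  "subgraph H G \<longleftrightarrow> simple_graph H \<and> verts H \<subseteq> verts G \<and> edges H \<subseteq> edges G"

definition induced_subgraph :: "'a ugraph \<Rightarrow> 'a set \<Rightarrow> 'a ugraph" where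
  "induced_subgraph G V = (V, {e \<in> edges G. e \<subseteq> V})"

definition connected_graph :: "'a ugraph \<Rightarrow> bool" where
  "connected_graph G \<longleftrightarrow> verts G \<noteq> {} \<and>
     (\<forall>u\<in>verts G. \<forall>v\<in>verts G. (u, v) \<in> {(x, y). {x, y} \<in> edges G}\<^sup>*)"

definition bipartite :: "'a ugraph \<Rightarrow> bool" where
  "bipartite G \<longleftrightarrow> (\<exists>A B. A \<union> B = verts G \<and> A \<inter> B = {} \<and>
     (\<forall>e\<in>edges G. \<exists>a\<in>A. \<exists>b\<in>B. e = {a, b}))"

definition maximal_bipartite_subgraph :: "'a ugraph \<Rightarrow> 'a ugraph \<Rightarrow> bool" where
  "maximal_bipartite_subgraph H K \<longleftrightarrow> subgraph H K \<and> bipartite H \<and>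
     (\<forall>H'. subgraph H' K \<and> bipartite H' \<and> subgraph H H' \<longrightarrow> H' = H)"

definition nabla :: "'n::finite ugraph \<Rightarrow> (real ^ 'n) set" where
  "nabla G = {x. \<exists>i j. {i, j} \<in> edges G \<and>
     (x = axis i 1 - axis j 1 \<or> x = - (axis i 1 - axis j 1))}"

definition adjacency_polytope :: "'n::finite ugraph \<Rightarrow> (real ^ 'n) set" where
  "adjacency_polytope G = convex hull (nabla G)"

definition nabla_face :: "(real ^ 'n) set \<Rightarrow> 'n::finite ugraph \<Rightarrow> bool" where
  "nabla_face F G \<longleftrightarrow> (\<exists>P. P face_of adjacency_polytope G \<and> F = nabla G \<inter> P)"

definition nabla_facet :: "(real ^ 'n) set \<Rightarrow> 'n::finite ugraph \<Rightarrow> bool" where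
  "nabla_facet F G \<longleftrightarrow> (\<exists>P. P facet_of adjacency_polytope G \<and> F = nabla G \<inter> P)"

text \<open>The graph \<open>G\<^sub>X\<close> of a nonempty subset \<open>X\<close> of \<open>nabla G\<close>. It is determined by \<open>X\<close> alone; since
  \<open>0 \<notin> nabla G\<close> for a simple graph \<open>G\<close>, no pair with \<open>i = j\<close> contributes.\<close>

definition graph_of_points :: "(real ^ 'n) set \<Rightarrow> 'n::finite ugraph" where
  "graph_of_points X =
     (let E = {{i, j} | i j. axis i 1 - axis j 1 \<in> X \<or> axis j 1 - axis i 1 \<in> X} in (\<Union>E, E))"

definition face_subgraph :: "'n::finite ugraph \<Rightarrow> 'n ugraph \<Rightarrow> bool" where
  "face_subgraph H G \<longleftrightarrow>
     (\<exists>F. nabla_face F G \<and> F \<noteq> {} \<and> F \<noteq> nabla G \<and> H = graph_of_points F)"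

definition facet_subgraph :: "'n::finite ugraph \<Rightarrow> 'n ugraph \<Rightarrow> bool" where
  "facet_subgraph H G \<longleftrightarrow> (\<exists>F. nabla_facet F G \<and> H = graph_of_points F)"

end

theory Submission
  imports Defs
begin

text \<open>A maximal bipartite subgraph of a connected graph is the same thing as a connected spanning
  subgraph consisting of all edges that cross some bipartition.  A proper nonempty face of the
  (centrally symmetric) polytope is cut out by an equation \<open>a \<bullet> x = b\<close> with \<open>b > 0\<close>, and its graph
  has the edges \<open>{i, j}\<close> with \<open>\<bar>a\<^sub>i - a\<^sub>j\<bar> = b\<close>, the maximum over the edges of \<open>G\<close>.  Along a connected
  subgraph of this kind the values \<open>a\<^sub>i\<close> agree modulo \<open>b\<close>, and the parity of the quotient is the
  bipartition; conversely a bipartition \<open>A\<close>, \<open>B\<close> of a subgraph gives the functional with values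
  \<open>1\<close> on \<open>A\<close>, \<open>-1\<close> on \<open>B\<close> and \<open>0\<close> elsewhere.  Finally, a face missing \<open>0\<close> is a facet if and only
  if it spans the same linear space as the polytope, which means that its graph is connected and
  spanning.\<close>

section \<open>Maximal bipartite subgraphs\<close>

definition adj_rel :: "'a ugraph \<Rightarrow> ('a \<times> 'a) set" where
  "adj_rel G = {(x, y). {x, y} \<in> edges G}"

definition cut_edges :: "'a ugraph \<Rightarrow> 'a set \<Rightarrow> 'a set \<Rightarrow> 'a set set" where
  "cut_edges G A B = {e \<in> edges G. \<exists>a\<in>A. \<exists>b\<in>B. e = {a, b}}"

lemma connected_graph_adj_rel:
  "connected_graph G \<longleftrightarrow> verts G \<noteq> {} \<and> (\<forall>u\<in>verts G. \<forall>v\<in>verts G. (u, v) \<in> (adj_rel G)\<^sup>*)"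
  by (simp add: connected_graph_def adj_rel_def)

section \<open>Elementary facts on simple graphs, subgraphs and connectedness\<close>

lemma simple_graph_edgeE:
  assumes "simple_graph G" "e \<in> edges G"
  obtains i j where "e = {i, j}" "i \<noteq> j" "i \<in> verts G" "j \<in> verts G"
  using assms unfolding simple_graph_def by (metis card_2_iff insert_subset)

lemma simple_graph_edgeD:
  assumes "simple_graph G" "{i, j} \<in> edges G"
  shows "i \<noteq> j" "i \<in> verts G" "j \<in> verts G"
  using assms unfolding simple_graph_def by fastforce+

lemma subgraph_induced_subgraph:
  assumes "subgraph H G"
  shows "subgraph H (induced_subgraph G (verts H))"
  using assms by (auto simp: subgraph_def induced_subgraph_def simple_graph_def)

lemma simple_graph_induced_subgraph: "simple_graph G \<Longrightarrow> simple_graph (induced_subgraph G V)"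
  by (simp add: induced_subgraph_def simple_graph_def)

lemma induced_subgraph_UNIV:
  assumes "verts G = UNIV"
  shows "induced_subgraph G UNIV = G"
  using assms by (simp add: induced_subgraph_def prod_eq_iff)

lemma connected_graph_mono:
  assumes "connected_graph H" "verts H = verts K" "edges H \<subseteq> edges K"
  shows "connected_graph K"
proof -
  have "adj_rel H \<subseteq> adj_rel K"
    using assms(3) by (auto simp: adj_rel_def)
  then have "(adj_rel H)\<^sup>* \<subseteq> (adj_rel K)\<^sup>*"
    by (rule rtrancl_mono)
  with assms(1,2) show ?thesis
    by (auto simp: connected_graph_adj_rel)
qed

text \<open>Induction along a path. This is the only way in which connectedness is exploited below:
  for cuts, for agreement of bipartitions, for levels modulo \<open>b\<close> and for telescoping
  sums.\<close>

lemma connected_graph_invariant: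
  assumes "connected_graph G" "u \<in> verts G" "v \<in> verts G" "P u"
    and "\<And>x y. {x, y} \<in> edges G \<Longrightarrow> P x \<Longrightarrow> P y"
  shows "P v"
proof -
  have "(u, v) \<in> (adj_rel G)\<^sup>*"
    using assms(1-3) by (simp add: connected_graph_adj_rel)
  then show ?thesis
    by induction (use assms(4,5) in \<open>auto simp: adj_rel_def\<close>)
qed

lemma connected_graph_exits:
  assumes "connected_graph G" "u \<in> verts G" "u \<in> C" "v \<in> verts G" "v \<notin> C"
  shows "\<exists>x y. {x, y} \<in> edges G \<and> x \<in> C \<and> y \<notin> C"
  using connected_graph_invariant[of G u v "\<lambda>x. x \<in> C"] assms by blast

text \<open>\<open>C\<close> is the set of points reachable from \<open>u\<close>. Edges are
  unordered, so closure under forward steps gives the equivalence.\<close>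

lemma not_connected_component:
  assumes "\<not> connected_graph G" "verts G \<noteq> {}"
  obtains C u v where "u \<in> verts G" "u \<in> C" "v \<in> verts G" "v \<notin> C"
    "\<And>x y. {x, y} \<in> edges G \<Longrightarrow> x \<in> C \<longleftrightarrow> y \<in> C"
proof -
  obtain u v where uv: "u \<in> verts G" "v \<in> verts G" "(u, v) \<notin> (adj_rel G)\<^sup>*"
    using assms by (auto simp: connected_graph_adj_rel)
  define C where "C = {x. (u, x) \<in> (adj_rel G)\<^sup>*}"
  have step: "y \<in> C" if "{x, y} \<in> edges G" "x \<in> C" for x y
    using that by (auto simp: C_def adj_rel_def intro: rtrancl_into_rtrancl)
  show ?thesis
  proof (rule that[of u C v])
    show "x \<in> C \<longleftrightarrow> y \<in> C" if "{x, y} \<in> edges G" for x y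
      using step[of x y] step[of y x] that by (auto simp: insert_commute)
  qed (use uv in \<open>auto simp: C_def\<close>)
qed

text \<open>An edge provides two vertices, so \<open>{v}\<close> is never everything and some edge
  leaves it. This matches the convention of \<open>graph_of_points\<close>, whose vertices are only
  endpoints of edges.\<close>

lemma connected_graph_verts:
  assumes "simple_graph G" "connected_graph G" "edges G \<noteq> {}"
  shows "verts G = \<Union>(edges G)"
proof
  show "\<Union>(edges G) \<subseteq> verts G"
    using assms(1) by (auto simp: simple_graph_def)
  obtain e where e: "e \<in> edges G"
    using assms(3) by blast
  then obtain i j where ij: "e = {i, j}" "i \<noteq> j" "i \<in> verts G" "j \<in> verts G"
    using assms(1) simple_graph_edgeE by metis
  show "verts G \<subseteq> \<Union>(edges G)"
  proof
    fix v assume "v \<in> verts G"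
    moreover have "\<exists>w\<in>verts G. w \<noteq> v"
      using ij by metis
    ultimately show "v \<in> \<Union>(edges G)"
      using connected_graph_exits[of G v "{v}"] assms(2) by blast
  qed
qed

section \<open>Bipartitions, cuts and maximality\<close>

lemma bipartite_edgeD:
  assumes "\<forall>e\<in>edges G. \<exists>a\<in>A. \<exists>b\<in>B. e = {a, b}" "A \<inter> B = {}" "{x, y} \<in> edges G"
  shows "x \<in> A \<longleftrightarrow> y \<notin> A"
proof -
  obtain a b where "a \<in> A" "b \<in> B" "{x, y} = {a, b}"
    using assms by blast
  with assms(2) show ?thesis
    by (auto simp: doubleton_eq_iff)
qed

text \<open>A connected graph has only one bipartition up to exchanging the sides. A bipartite
  \<open>H'\<close> above \<open>H\<close> must therefore use \<open>A\<close> and \<open>B\<close>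
  again, and all edges of \<open>K\<close> between them are already in \<open>H\<close>.\<close>

lemma connected_cut_maximal_bipartite:
  assumes sub: "subgraph H K" and con: "connected_graph H" and vs: "verts H = verts K"
    and AB: "A \<union> B = verts H" "A \<inter> B = {}" and es: "edges H = cut_edges K A B"
  shows "maximal_bipartite_subgraph H K"
  unfolding maximal_bipartite_subgraph_def
proof (intro conjI allI impI)
  have H_cut: "\<forall>e\<in>edges H. \<exists>a\<in>A. \<exists>b\<in>B. e = {a, b}"
    using es by (auto simp: cut_edges_def)
  with AB show "bipartite H"
    unfolding bipartite_def by blast
  fix H' assume H': "subgraph H' K \<and> bipartite H' \<and> subgraph H H'"
  then have vs': "verts H' = verts H"
    using vs by (auto simp: subgraph_def)
  obtain A' B' where AB': "A' \<union> B' = verts H'" "A' \<inter> B' = {}"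
    and cut': "\<forall>e\<in>edges H'. \<exists>a\<in>A'. \<exists>b\<in>B'. e = {a, b}"
    using H' unfolding bipartite_def by blast
  \<comment> \<open>Both bipartitions switch sides along an edge of \<open>H\<close>, so whether
    they agree at a vertex is constant on \<open>H\<close>.\<close>
  have sides: "(u \<in> A \<longleftrightarrow> u \<in> A') \<longleftrightarrow> (v \<in> A \<longleftrightarrow> v \<in> A')"
    if "u \<in> verts H" "v \<in> verts H" for u v
  proof (rule connected_graph_invariant[OF con that])
    fix x y assume e: "{x, y} \<in> edges H"
    then have "{x, y} \<in> edges H'"
      using H' by (auto simp: subgraph_def)
    with e show "(u \<in> A \<longleftrightarrow> u \<in> A') \<longleftrightarrow> (y \<in> A \<longleftrightarrow> y \<in> A')"
      if "(u \<in> A \<longleftrightarrow> u \<in> A') \<longleftrightarrow> (x \<in> A \<longleftrightarrow> x \<in> A')"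
      using that bipartite_edgeD[OF H_cut AB(2)] bipartite_edgeD[OF cut' AB'(2)] by blast
  qed simp
  have "e \<in> edges H" if e: "e \<in> edges H'" for e
  proof -
    obtain x y where xy: "e = {x, y}" "x \<in> verts H'" "y \<in> verts H'"
      using e H' simple_graph_edgeE[of H' e] unfolding subgraph_def by metis
    have "x \<in> A' \<longleftrightarrow> y \<notin> A'"
      using bipartite_edgeD[OF cut' AB'(2)] e xy(1) by blast
    then have "x \<in> A \<longleftrightarrow> y \<notin> A"
      using sides[of x y] xy vs' by blast
    then have "\<exists>a\<in>A. \<exists>b\<in>B. e = {a, b}"
      using xy AB(1) vs' by (metis Un_iff insert_commute)
    moreover have "e \<in> edges K"
      using e H' by (auto simp: subgraph_def)
    ultimately show ?thesis
      using es by (simp add: cut_edges_def)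
  qed
  then have "edges H' = edges H"
    using H' by (auto simp: subgraph_def)
  with vs' show "H' = H"
    by (simp add: prod_eq_iff)
qed (use sub in auto)

text \<open>Maximality is used twice: adding all vertices and all crossing edges keeps the graph
  bipartite, which makes \<open>H\<close> a spanning cut; and if \<open>H\<close> were disconnected,
  a further edge of \<open>K\<close> joining two components could be added.\<close>

lemma maximal_bipartite_cut:
  assumes simp: "simple_graph K" and con: "connected_graph K"
    and max: "maximal_bipartite_subgraph H K"
  obtains A B where "verts H = verts K" "A \<union> B = verts H" "A \<inter> B = {}"
    "edges H = cut_edges K A B" "connected_graph H"
proof -
  have sub: "subgraph H K" and bip: "bipartite H"
    and maxD: "\<And>H'. subgraph H' K \<Longrightarrow> bipartite H' \<Longrightarrow> subgraph H H' \<Longrightarrow> H' = H"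
    using max by (auto simp: maximal_bipartite_subgraph_def)
  obtain A0 B where AB0: "A0 \<union> B = verts H" "A0 \<inter> B = {}"
    and cut0: "\<forall>e\<in>edges H. \<exists>a\<in>A0. \<exists>b\<in>B. e = {a, b}"
    using bip unfolding bipartite_def by blast
  \<comment> \<open>Vertices of \<open>K\<close> missing from \<open>H\<close> may go to either
    side; they are put on the side of \<open>A0\<close>.\<close>
  define A where "A = verts K - B"
  have vHK: "verts H \<subseteq> verts K"
    using sub by (simp add: subgraph_def)
  have AB: "A \<union> B = verts K" "A \<inter> B = {}" "A0 \<subseteq> A"
    using AB0 vHK by (auto simp: A_def)
  have sgK: "simple_graph (verts K, E)" if "E \<subseteq> edges K" for E
    using simp that by (auto simp: simple_graph_def)
  have "(verts K, cut_edges K A B) = H"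
  proof (rule maxD)
    show "subgraph (verts K, cut_edges K A B) K"
      using sgK[of "cut_edges K A B"] by (auto simp: subgraph_def cut_edges_def)
    show "bipartite (verts K, cut_edges K A B)"
      unfolding bipartite_def using AB by (intro exI[of _ A] exI[of _ B]) (auto simp: cut_edges_def)
    show "subgraph H (verts K, cut_edges K A B)"
      using sub cut0 AB(3) by (fastforce simp: subgraph_def cut_edges_def)
  qed
  then have vH: "verts H = verts K" and eH: "edges H = cut_edges K A B"
    by auto
  have cutH: "\<forall>e\<in>edges H. \<exists>a\<in>A. \<exists>b\<in>B. e = {a, b}"
    by (auto simp: eH cut_edges_def)
  have "connected_graph H"
  proof (rule ccontr)
    assume "\<not> connected_graph H"
    moreover have "verts H \<noteq> {}"
      using con vH by (simp add: connected_graph_adj_rel)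
    ultimately obtain C u v where C: "u \<in> verts H" "u \<in> C" "v \<in> verts H" "v \<notin> C"
      "\<And>x y. {x, y} \<in> edges H \<Longrightarrow> x \<in> C \<longleftrightarrow> y \<in> C"
      using not_connected_component by metis
    obtain x y where xy: "{x, y} \<in> edges K" "x \<in> C" "y \<notin> C"
      using connected_graph_exits[OF con] C vH by metis
    have xyV: "x \<in> verts K" "y \<in> verts K"
      using simple_graph_edgeD[OF simp xy(1)] by auto
    have not_H: "{x, y} \<notin> edges H"
      using C(5) xy by blast
    then have same: "x \<in> A \<longleftrightarrow> y \<in> A"
      using xy(1) xyV AB(1,2) by (auto simp: eH cut_edges_def insert_commute)
    \<comment> \<open>exchanging the two sides on the component \<open>C\<close> makes room for the edge \<open>{x, y}\<close>\<close>
    define A' where "A' = {z \<in> verts K. (z \<in> A) \<noteq> (z \<in> C)}"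
    define B' where "B' = verts K - A'"
    have cross: "\<exists>a\<in>A'. \<exists>b\<in>B'. {p, q} = {a, b}"
      if "p \<in> verts K" "q \<in> verts K" "p \<in> A' \<longleftrightarrow> q \<notin> A'" for p q
      using that unfolding B'_def by (metis DiffI insert_commute)
    let ?H' = "(verts K, insert {x, y} (edges H))"
    have "?H' = H"
    proof (rule maxD)
      show "subgraph ?H' K"
        using sgK[of "insert {x, y} (edges H)"] xy(1) sub by (auto simp: subgraph_def)
      show "subgraph H ?H'"
        using sub by (auto simp: subgraph_def)
      have "\<exists>a\<in>A'. \<exists>b\<in>B'. e = {a, b}" if "e \<in> insert {x, y} (edges H)" for e
        using that
      proof
        assume "e = {x, y}"
        then show ?thesis
          using cross[of x y] xyV same xy by (auto simp: A'_def)
      next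
        assume e: "e \<in> edges H"
        then obtain p q where pq: "e = {p, q}" "p \<in> verts K" "q \<in> verts K"
          using sub vH simple_graph_edgeE[of H e] unfolding subgraph_def by metis
        moreover have "p \<in> A \<longleftrightarrow> q \<notin> A"
          using bipartite_edgeD[OF cutH AB(2)] e pq(1) by blast
        moreover have "p \<in> C \<longleftrightarrow> q \<in> C"
          using C(5) e pq(1) by blast
        ultimately show ?thesis
          using cross[of p q] by (auto simp: A'_def)
      qed
      moreover have "A' \<union> B' = verts K" "A' \<inter> B' = {}"
        by (auto simp: A'_def B'_def)
      ultimately show "bipartite ?H'"
        unfolding bipartite_def fst_conv snd_conv by blast
    qed
    with not_H show False
      by (metis insertI1 snd_conv)
  qed
  with vH eH AB show ?thesis
    using that by metis
qed

section \<open>Faces of the adjacency polytope\<close>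

lemma inner_axis_diff:
  fixes a :: "real ^ 'n"
  shows "a \<bullet> (axis i 1 - axis j 1) = a $ i - a $ j"
  by (simp add: inner_diff_right inner_axis)

text \<open>The coordinates \<open>1\<close> and \<open>-1\<close> reveal the two indices. Hence a
  point of \<open>nabla G\<close> determines its oriented edge.\<close>

lemma axis_diff_eq_iff:
  assumes "i \<noteq> j"
  shows "(axis i 1 - axis j 1 :: real ^ 'n) = axis k 1 - axis l 1 \<longleftrightarrow> i = k \<and> j = l"
proof
  assume eq: "(axis i 1 - axis j 1 :: real ^ 'n) = axis k 1 - axis l 1"
  have "(axis i 1 - axis j 1 :: real ^ 'n) $ i = 1" "(axis i 1 - axis j 1 :: real ^ 'n) $ j = -1"
    using assms by (auto simp: axis_def)
  with eq have "(axis k 1 - axis l 1 :: real ^ 'n) $ i = 1" "(axis k 1 - axis l 1 :: real ^ 'n) $ j = -1"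
    by auto
  then show "i = k \<and> j = l"
    by (auto simp: axis_def split: if_splits)
qed simp

lemma nabla_eq:
  fixes G :: "'n::finite ugraph"
  shows "nabla G = {axis i 1 - axis j 1 | i j. {i, j} \<in> edges G}"
proof -
  have "\<exists>k l. - (axis i 1 - axis j 1 :: real ^ 'n) = axis k 1 - axis l 1 \<and> {k, l} \<in> edges G"
    if "{i, j} \<in> edges G" for i j
    using that by (intro exI[of _ j] exI[of _ i]) (simp add: insert_commute)
  then show ?thesis
    unfolding nabla_def by blast
qed

lemma axis_diff_in_nabla:
  fixes G :: "'n::finite ugraph"
  assumes "simple_graph G"
  shows "axis i 1 - axis j 1 \<in> nabla G \<longleftrightarrow> {i, j} \<in> edges G"
proof
  assume "axis i 1 - axis j 1 \<in> nabla G"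
  then obtain k l where kl: "axis k 1 - axis l 1 = (axis i 1 - axis j 1 :: real ^ 'n)" "{k, l} \<in> edges G"
    unfolding nabla_eq by auto
  then show "{i, j} \<in> edges G"
    using axis_diff_eq_iff simple_graph_edgeD(1)[OF assms kl(2)] by metis
qed (auto simp: nabla_eq)

lemma finite_nabla: "finite (nabla G)"
proof -
  have "nabla G \<subseteq> (\<lambda>(i, j). axis i 1 - axis j 1) ` UNIV"
    by (auto simp: nabla_eq)
  then show ?thesis
    by (rule finite_subset) simp
qed

lemma polytope_adjacency_polytope: "polytope (adjacency_polytope G)"
  unfolding adjacency_polytope_def polytope_def using finite_nabla by blast

lemma nabla_subset_adjacency_polytope: "nabla G \<subseteq> adjacency_polytope G"
  by (simp add: adjacency_polytope_def hull_subset)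

lemma uminus_in_nabla: "x \<in> nabla G \<Longrightarrow> - x \<in> nabla G"
  unfolding nabla_def by force

section \<open>Supporting hyperplanes and the edges they select\<close>

lemma adjacency_polytope_subset_le_iff:
  "adjacency_polytope G \<subseteq> {x. a \<bullet> x \<le> b} \<longleftrightarrow> (\<forall>i j. {i, j} \<in> edges G \<longrightarrow> a $ i - a $ j \<le> b)"
proof -
  have "adjacency_polytope G \<subseteq> {x. a \<bullet> x \<le> b} \<longleftrightarrow> nabla G \<subseteq> {x. a \<bullet> x \<le> b}"
    using nabla_subset_adjacency_polytope[of G]
      hull_minimal[of "nabla G" "{x. a \<bullet> x \<le> b}" convex] convex_halfspace_le[of a b]
    unfolding adjacency_polytope_def by blast
  also have "\<dots> \<longleftrightarrow> (\<forall>i j. {i, j} \<in> edges G \<longrightarrow> a $ i - a $ j \<le> b)"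
    unfolding nabla_eq by (auto simp: subset_iff simp flip: inner_axis_diff)
  finally show ?thesis .
qed

text \<open>Faces of a polytope are exposed. By central symmetry \<open>a\<close> and
  \<open>- a\<close> are both bounded by \<open>b\<close>, so \<open>b \<le> 0\<close> would make
  \<open>a\<close> constantly equal to \<open>b\<close> on the polytope and the face
  improper.\<close>

lemma proper_face_supporting:
  assumes "P face_of adjacency_polytope G" "P \<noteq> {}" "P \<noteq> adjacency_polytope G"
  obtains a b where "b > 0" "adjacency_polytope G \<subseteq> {x. a \<bullet> x \<le> b}"
    "P = adjacency_polytope G \<inter> {x. a \<bullet> x = b}"
proof -
  let ?Q = "adjacency_polytope G"
  have "P exposed_face_of ?Q"
    using assms(1) exposed_face_of_polyhedron polytope_imp_polyhedron[OF polytope_adjacency_polytope]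
    by blast
  then obtain a b where ab: "?Q \<subseteq> {x. a \<bullet> x \<le> b}" "P = ?Q \<inter> {x. a \<bullet> x = b}"
    unfolding exposed_face_of_def by blast
  have "{i, j} \<in> edges G \<Longrightarrow> (- a) $ i - (- a) $ j \<le> b" for i j
    using ab(1) by (auto simp: adjacency_polytope_subset_le_iff insert_commute)
  then have sym: "?Q \<subseteq> {x. - a \<bullet> x \<le> b}"
    using adjacency_polytope_subset_le_iff[of G "- a" b] by simp
  have "b > 0"
  proof (rule ccontr)
    assume "\<not> b > 0"
    then have "a \<bullet> x = b" if "x \<in> ?Q" for x
      using that ab(1) sym by fastforce
    with ab(2) assms(3) show False
      by auto
  qed
  with ab show ?thesis
    using that by blast
qed

text \<open>Edges are unordered, so it suffices that one orientation attains \<open>b\<close>; this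
  absorbs the two alternatives in \<open>graph_of_points\<close>.\<close>

lemma graph_of_points_supporting:
  assumes G: "simple_graph G" and F: "F = nabla G \<inter> {x. a \<bullet> x = b}"
  shows "graph_of_points F =
    (\<Union>{e. \<exists>i j. e = {i, j} \<and> e \<in> edges G \<and> a $ i - a $ j = b},
     {e. \<exists>i j. e = {i, j} \<and> e \<in> edges G \<and> a $ i - a $ j = b})"
proof -
  have mem: "axis i 1 - axis j 1 \<in> F \<longleftrightarrow> {i, j} \<in> edges G \<and> a $ i - a $ j = b" for i j
    using axis_diff_in_nabla[OF G] by (simp add: F inner_axis_diff)
  have "{{i, j} | i j. axis i 1 - axis j 1 \<in> F \<or> axis j 1 - axis i 1 \<in> F} =
      {e. \<exists>i j. e = {i, j} \<and> e \<in> edges G \<and> a $ i - a $ j = b}"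
    unfolding mem by (fastforce simp: insert_commute)
  then show ?thesis
    unfolding graph_of_points_def Let_def by simp
qed

lemma face_subgraph_supporting:
  fixes G :: "'n::finite ugraph"
  assumes G: "simple_graph G" and H: "face_subgraph H G"
  obtains a :: "real ^ 'n" and b :: real where "b > 0" "\<forall>i j. {i, j} \<in> edges G \<longrightarrow> a $ i - a $ j \<le> b"
    "edges H = {e. \<exists>i j. e = {i, j} \<and> e \<in> edges G \<and> a $ i - a $ j = b}"
proof -
  obtain P where P: "P face_of adjacency_polytope G" "nabla G \<inter> P \<noteq> {}"
      "nabla G \<inter> P \<noteq> nabla G" "H = graph_of_points (nabla G \<inter> P)"
    using H unfolding face_subgraph_def nabla_face_def by blast
  have "P \<noteq> {}" "P \<noteq> adjacency_polytope G"
    using P(2,3) nabla_subset_adjacency_polytope[of G] by auto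
  then obtain a b where ab: "b > 0" "adjacency_polytope G \<subseteq> {x. a \<bullet> x \<le> b}"
      "P = adjacency_polytope G \<inter> {x. a \<bullet> x = b}"
    using proper_face_supporting[OF P(1)] by blast
  have "nabla G \<inter> P = nabla G \<inter> {x. a \<bullet> x = b}"
    using ab(3) nabla_subset_adjacency_polytope[of G] by blast
  then have eH: "edges H = {e. \<exists>i j. e = {i, j} \<and> e \<in> edges G \<and> a $ i - a $ j = b}"
    using P(4) graph_of_points_supporting[OF G] by simp
  with ab(1,2) show ?thesis
    unfolding adjacency_polytope_subset_le_iff by (intro that[OF ab(1) _ eH])
qed

text \<open>Along edges of \<open>H\<close> the value of \<open>a\<close> changes by exactly
  \<open>b\<close>, so each vertex has an integer level, and parity of levels is a bipartition.
  Conversely, an edge of \<open>G\<close> between vertices of \<open>H\<close> of opposite parity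
  changes the level by at most one, hence by exactly one, and belongs to \<open>H\<close>.\<close>

lemma face_subgraph_maximal_bipartite:
  fixes G :: "'n::finite ugraph"
  assumes G: "simple_graph G" and sub: "subgraph H G" and con: "connected_graph H"
    and face: "face_subgraph H G"
  shows "maximal_bipartite_subgraph H (induced_subgraph G (verts H))"
proof -
  obtain a :: "real ^ 'n" and b :: real where b: "b > 0" and le: "\<forall>i j. {i, j} \<in> edges G \<longrightarrow> a $ i - a $ j \<le> b"
    and eH: "edges H = {e. \<exists>i j. e = {i, j} \<and> e \<in> edges G \<and> a $ i - a $ j = b}"
    by (rule face_subgraph_supporting[OF G face])
  obtain r where r: "r \<in> verts H"
    using con by (auto simp: connected_graph_adj_rel)
  have step: "a $ y = a $ x + b \<or> a $ y = a $ x - b" if "{x, y} \<in> edges H" for x y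
    using that by (auto simp: eH doubleton_eq_iff)
  have "\<exists>k::int. a $ v = a $ r + of_int k * b" if v: "v \<in> verts H" for v
  proof (rule connected_graph_invariant[OF con r v])
    show "\<exists>k::int. a $ r = a $ r + of_int k * b"
      by (intro exI[of _ 0]) simp
    fix x y assume "{x, y} \<in> edges H" "\<exists>k::int. a $ x = a $ r + of_int k * b"
    then obtain k :: int where "a $ x = a $ r + of_int k * b"
        "a $ y = a $ x + b \<or> a $ y = a $ x - b"
      using step by blast
    then have "a $ y = a $ r + of_int (k + 1) * b \<or> a $ y = a $ r + of_int (k - 1) * b"
      by (auto simp: algebra_simps)
    then show "\<exists>k::int. a $ y = a $ r + of_int k * b"
      by blast
  qed
  then obtain k :: "_ \<Rightarrow> int" where k: "\<And>v. v \<in> verts H \<Longrightarrow> a $ v = a $ r + of_int (k v) * b"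
    by metis
  have diff: "a $ x - a $ y = of_int (k x - k y) * b" if "x \<in> verts H" "y \<in> verts H" for x y
    using k that by (simp add: algebra_simps)
  let ?A = "{v \<in> verts H. even (k v)}" and ?B = "{v \<in> verts H. odd (k v)}"
  have "edges H = cut_edges (induced_subgraph G (verts H)) ?A ?B"
  proof (intro equalityI subsetI)
    fix e assume e: "e \<in> edges H"
    then obtain i j where ij: "e = {i, j}" "e \<in> edges G" "a $ i - a $ j = b"
      using eH by blast
    have iV: "i \<in> verts H" "j \<in> verts H"
      using simple_graph_edgeD e ij(1) sub unfolding subgraph_def by metis+
    have "of_int (k i - k j) * b = 1 * b"
      using diff[OF iV] ij(3) by simp
    then have "k i - k j = 1"
      using b by (metis less_irrefl mult_right_cancel of_int_eq_1_iff)
    then have "k i = k j + 1"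
      by simp
    then have "(i \<in> ?A \<and> j \<in> ?B) \<or> (j \<in> ?A \<and> i \<in> ?B)"
      using iV by auto
    then have "\<exists>x\<in>?A. \<exists>y\<in>?B. e = {x, y}"
      unfolding ij(1) using insert_commute[of i j "{}"] by blast
    then show "e \<in> cut_edges (induced_subgraph G (verts H)) ?A ?B"
      using ij(1,2) iV by (simp add: cut_edges_def induced_subgraph_def)
  next
    fix e assume "e \<in> cut_edges (induced_subgraph G (verts H)) ?A ?B"
    then obtain x y where xy: "e = {x, y}" "e \<in> edges G" "x \<in> verts H" "y \<in> verts H"
        "even (k x)" "odd (k y)"
      by (auto simp: cut_edges_def induced_subgraph_def)
    \<comment> \<open>The bound holds for both orientations of the edge, so the levels differ by at
      most one; parity then excludes difference zero.\<close>
    have "of_int (k x - k y) * b \<le> 1 * b" "of_int (k y - k x) * b \<le> 1 * b"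
      using le[rule_format, of x y] le[rule_format, of y x] xy diff[of x y] diff[of y x] by (auto simp: insert_commute)
    then have "of_int (k x - k y) \<le> (1::real)" "of_int (k y - k x) \<le> (1::real)"
      using b mult_right_le_imp_le by blast+
    then have "k x - k y \<le> 1" "k y - k x \<le> 1"
      by linarith+
    moreover have "k x \<noteq> k y"
      using xy by auto
    ultimately have "k x - k y = 1 \<or> k y - k x = 1"
      by linarith
    then have "a $ x - a $ y = b \<or> a $ y - a $ x = b"
      using diff[of x y] diff[of y x] xy by auto
    then show "e \<in> edges H"
      using xy(1,2) unfolding eH by (auto simp: insert_commute)
  qed
  moreover have "subgraph H (induced_subgraph G (verts H))"
    using sub by (rule subgraph_induced_subgraph)
  ultimately show ?thesis
    using con by (intro connected_cut_maximal_bipartite[where A = ?A and B = ?B])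
      (auto simp: induced_subgraph_def)
qed

lemma maximal_bipartite_face_subgraph:
  fixes G :: "'n::finite ugraph"
  assumes G: "simple_graph G" and sub: "subgraph H G" and con: "connected_graph H"
    and ne: "edges H \<noteq> {}"
    and max: "maximal_bipartite_subgraph H (induced_subgraph G (verts H))"
  shows "face_subgraph H G"
proof -
  let ?K = "induced_subgraph G (verts H)"
  have "connected_graph ?K"
    using con sub by (intro connected_graph_mono[OF con])
      (auto simp: induced_subgraph_def subgraph_def simple_graph_def)
  then obtain A B where AB: "A \<union> B = verts H" "A \<inter> B = {}" "edges H = cut_edges ?K A B"
    using maximal_bipartite_cut[OF simple_graph_induced_subgraph[OF G] _ max] by metis
  \<comment> \<open>The difference \<open>2\<close> occurs only from \<open>A\<close> to
    \<open>B\<close>. The value \<open>0\<close> off \<open>H\<close> keeps edges with an end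
    outside \<open>H\<close> at difference at most \<open>1\<close>, hence off the face.\<close>
  define a :: "real ^ 'n" where "a = (\<chi> i. if i \<in> A then 1 else if i \<in> B then -1 else 0)"
  have le: "a $ i - a $ j \<le> 2" for i j
    by (simp add: a_def)
  have eq: "a $ i - a $ j = 2 \<longleftrightarrow> i \<in> A \<and> j \<in> B" for i j
    using AB(2) by (auto simp: a_def)
  let ?P = "adjacency_polytope G \<inter> {x. a \<bullet> x = 2}"
  let ?F = "nabla G \<inter> ?P"
  have "?P face_of adjacency_polytope G"
  proof (rule face_of_Int_supporting_hyperplane_le)
    show "convex (adjacency_polytope G)"
      by (simp add: adjacency_polytope_def)
    show "a \<bullet> x \<le> 2" if "x \<in> adjacency_polytope G" for x
      using that adjacency_polytope_subset_le_iff[of G a 2] le by blast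
  qed
  then have "nabla_face ?F G"
    unfolding nabla_face_def by blast
  moreover have F: "?F = nabla G \<inter> {x. a \<bullet> x = 2}"
    using nabla_subset_adjacency_polytope[of G] by blast
  have es: "{e. \<exists>i j. e = {i, j} \<and> e \<in> edges G \<and> a $ i - a $ j = 2} = edges H"
    unfolding AB(3) eq using AB(1) by (auto simp: cut_edges_def induced_subgraph_def)
  have "H = graph_of_points ?F"
    using graph_of_points_supporting[OF G F] es connected_graph_verts[OF _ con ne] sub
    by (simp add: subgraph_def prod_eq_iff)
  moreover
  obtain i j where ij: "{i, j} \<in> edges G" "a $ i - a $ j = 2"
    using ne unfolding es[symmetric] by blast
  \<comment> \<open>The reversed edge has value \<open>-2\<close>, which shows that the face is
    proper.\<close>
  then have "axis i 1 - axis j 1 \<in> ?F" "axis j 1 - axis i 1 \<in> nabla G" "axis j 1 - axis i 1 \<notin> ?F"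
    unfolding F by (auto simp: inner_axis_diff axis_diff_in_nabla[OF G] insert_commute)
  then have "?F \<noteq> {}" "?F \<noteq> nabla G"
    by blast+
  ultimately show ?thesis
    unfolding face_subgraph_def by blast
qed

section \<open>Facets\<close>

lemma aff_dim_insert_0:
  fixes S :: "'a::euclidean_space set"
  shows "aff_dim (insert 0 S) = int (dim S)"
  by (metis aff_dim_zero dim_span hull_inc insertI1 span_insert_0)

text \<open>The origin is the midpoint of \<open>x\<close> and \<open>- x\<close>, so the affine
  hull of the polytope is a linear space.\<close>

lemma aff_dim_adjacency_polytope:
  assumes "nabla G \<noteq> {}"
  shows "aff_dim (adjacency_polytope G) = int (dim (adjacency_polytope G))"
proof -
  obtain x where "x \<in> nabla G"
    using assms by blast
  then have "x \<in> adjacency_polytope G" "- x \<in> adjacency_polytope G"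
    using uminus_in_nabla nabla_subset_adjacency_polytope by blast+
  then have "(1/2) *\<^sub>R x + (1/2) *\<^sub>R (- x) \<in> adjacency_polytope G"
    by (intro convexD) (auto simp: adjacency_polytope_def)
  then show ?thesis
    by (intro aff_dim_zero hull_inc) simp
qed

text \<open>The facet has one dimension less than the polytope but its hyperplane misses the origin,
  so both have the same linear span. A disconnected or non-spanning \<open>H\<close> would leave
  some functional that vanishes on \<open>?F\<close> but not on all of
  \<open>nabla G\<close>.\<close>

lemma facet_subgraph_connected:
  fixes G :: "'n::finite ugraph"
  assumes G: "simple_graph G" "verts G = UNIV" "connected_graph G" "edges G \<noteq> {}"
    and facet: "facet_subgraph H G"
  shows "face_subgraph H G \<and> connected_graph H \<and> verts H = UNIV"
proof -
  let ?Q = "adjacency_polytope G"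
  obtain P where P: "P facet_of ?Q" and H: "H = graph_of_points (nabla G \<inter> P)"
    using facet unfolding facet_subgraph_def nabla_facet_def by blast
  let ?F = "nabla G \<inter> P"
  have face: "P face_of ?Q" and Pne: "P \<noteq> {}" and dimP: "aff_dim P = aff_dim ?Q - 1"
    using P by (auto simp: facet_of_def)
  have PQ: "P \<noteq> ?Q"
    using dimP by auto
  obtain a b where ab: "b > 0" "?Q \<subseteq> {x. a \<bullet> x \<le> b}" "P = ?Q \<inter> {x. a \<bullet> x = b}"
    using proper_face_supporting[OF face Pne] PQ by blast
  \<comment> \<open>A face of a convex hull of finitely many points is the hull of some of them;
    thus \<open>?F\<close> is nonempty and spans \<open>P\<close>.\<close>
  obtain T where T: "T \<subseteq> nabla G" "P = convex hull T"
    using face_of_convex_hull_subset[of "nabla G" P] face finite_nabla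
    unfolding adjacency_polytope_def by (metis finite_imp_compact)
  then have TF: "T \<subseteq> ?F"
    using hull_subset[of T convex] by auto
  then have Fne: "?F \<noteq> {}"
    using T(2) Pne by auto
  then have nne: "nabla G \<noteq> {}"
    by blast
  have "x \<notin> P" if "a \<bullet> x \<noteq> b" for x
    using that ab(3) by blast
  moreover obtain x where x: "x \<in> ?F"
    using Fne by blast
  \<comment> \<open>The opposite point has value \<open>- b\<close>, different from \<open>b\<close>
    since \<open>b > 0\<close>.\<close>
  then have "a \<bullet> (- x) \<noteq> b"
    using ab by auto
  ultimately have "- x \<in> nabla G - ?F"
    using x uminus_in_nabla by blast
  then have "?F \<noteq> nabla G"
    by blast
  with face Fne H have "face_subgraph H G"
    unfolding face_subgraph_def nabla_face_def by blast
  have eH: "edges H = {{i, j} | i j. axis i 1 - axis j 1 \<in> ?F \<or> axis j 1 - axis i 1 \<in> ?F}"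
    unfolding H graph_of_points_def Let_def by simp
  have "affine hull P \<subseteq> {x. a \<bullet> x = b}"
    by (rule hull_minimal) (use ab(3) affine_hyperplane in auto)
  then have "0 \<notin> affine hull P"
    using ab(1) by auto
  \<comment> \<open>The one dimension gained by adjoining the origin cancels the one lost in passing
    to a facet.\<close>
  then have "aff_dim (insert 0 P) = aff_dim P + 1"
    by (simp add: aff_dim_insert)
  moreover have "aff_dim (insert 0 P) = int (dim P)"
    by (rule aff_dim_insert_0)
  ultimately have "dim P = dim ?Q"
    using dimP aff_dim_adjacency_polytope[OF nne] by simp
  then have spanPQ: "span P = span ?Q"
    using ab(3) by (intro dim_eq_span) auto
  have "P \<subseteq> span ?F"
    using T(2) TF by (meson convex_hull_subset_span order_trans span_mono)
  then have span: "?Q \<subseteq> span ?F"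
    using spanPQ by (metis span_superset span_minimal subspace_span order_trans)
  \<comment> \<open>the indicator of a union of components of \<open>H\<close> vanishes on \<open>F\<close>, hence on \<open>nabla G\<close>\<close>
  have no_cut: False
    if C: "u \<in> C" "v \<notin> C" "\<And>x y. {x, y} \<in> edges H \<Longrightarrow> x \<in> C \<longleftrightarrow> y \<in> C" for C u v
  proof -
    define c :: "real ^ 'n" where "c = (\<chi> i. if i \<in> C then 1 else 0)"
    obtain x y where xy: "{x, y} \<in> edges G" "x \<in> C" "y \<notin> C"
      using connected_graph_exits[OF G(3)] C G(2) by (metis UNIV_I)
    have "?F \<subseteq> {z. c \<bullet> z = 0}"
    proof
      fix z assume z: "z \<in> ?F"
      then obtain i j where ij: "z = axis i 1 - axis j 1"
        unfolding nabla_eq by blast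
      then have "{i, j} \<in> edges H"
        using z unfolding eH by blast
      then have "i \<in> C \<longleftrightarrow> j \<in> C"
        using C(3) by blast
      then show "z \<in> {z. c \<bullet> z = 0}"
        by (simp add: ij inner_axis_diff c_def)
    qed
    then have "span ?F \<subseteq> {z. c \<bullet> z = 0}"
      by (intro span_minimal subspace_hyperplane)
    moreover have "axis x 1 - axis y 1 \<in> span ?F"
      using xy(1) span nabla_subset_adjacency_polytope axis_diff_in_nabla[OF G(1)] by blast
    ultimately have "c \<bullet> (axis x 1 - axis y 1) = 0"
      by blast
    with xy(2,3) show False
      by (simp add: inner_axis_diff c_def)
  qed
  have vH: "verts H = \<Union>(edges H)"
    unfolding H graph_of_points_def Let_def by simp
  obtain p q where pq: "p \<noteq> (q :: 'n)"
    using G(1,4) simple_graph_edgeE[of G] by (metis all_not_in_conv)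
  have verts: "verts H = UNIV"
  proof (rule ccontr)
    assume "verts H \<noteq> UNIV"
    then obtain v where v: "v \<notin> \<Union>(edges H)"
      using vH by blast
    \<comment> \<open>A vertex on no edge of \<open>H\<close> is treated as a component
      \<open>{v}\<close>; the excluded cut needs a second vertex outside it.\<close>
    obtain w where "w \<noteq> v"
      using pq by metis
    then show False
      using v by (intro no_cut[of v "{v}" w]) auto
  qed
  moreover have "connected_graph H"
  proof (rule ccontr)
    assume "\<not> connected_graph H"
    then show False
      using not_connected_component[of H] no_cut verts by (metis UNIV_I empty_iff)
  qed
  ultimately show ?thesis
    using \<open>face_subgraph H G\<close> by blast
qed

text \<open>Differences along a path in \<open>H\<close> telescope, so \<open>?F\<close> spans every
  \<open>axis v 1 - axis u 1\<close> and thus \<open>nabla G\<close>. This bounds the dimension of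
  the face from below, while properness bounds it from above.\<close>

lemma connected_face_subgraph_facet:
  fixes G :: "'n::finite ugraph"
  assumes G: "simple_graph G" and H: "connected_graph H" "verts H = UNIV" "face_subgraph H G"
  shows "facet_subgraph H G"
proof -
  let ?Q = "adjacency_polytope G"
  obtain P where face: "P face_of ?Q" and ne: "nabla G \<inter> P \<noteq> {}" "nabla G \<inter> P \<noteq> nabla G"
    and HF: "H = graph_of_points (nabla G \<inter> P)"
    using H(3) unfolding face_subgraph_def nabla_face_def by blast
  let ?F = "nabla G \<inter> P"
  have PQ: "P \<subset> ?Q"
    using face_of_imp_subset[OF face] ne nabla_subset_adjacency_polytope[of G] by blast
  have Qconv: "convex ?Q"
    by (simp add: adjacency_polytope_def)
  have eH: "edges H = {{i, j} | i j. axis i 1 - axis j 1 \<in> ?F \<or> axis j 1 - axis i 1 \<in> ?F}"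
    unfolding HF graph_of_points_def Let_def by simp
  \<comment> \<open>Only one orientation of an edge need lie in \<open>?F\<close>, but a span is
    closed under negation.\<close>
  have edge: "axis j 1 - axis i 1 \<in> span ?F" if "{i, j} \<in> edges H" for i j
  proof -
    have "\<exists>k l. {i, j} = {k, l} \<and> (axis k 1 - axis l 1 \<in> ?F \<or> axis l 1 - axis k 1 \<in> ?F)"
      using that unfolding eH mem_Collect_eq .
    then obtain k l where kl: "{i, j} = {k, l}" "axis k 1 - axis l 1 \<in> ?F \<or> axis l 1 - axis k 1 \<in> ?F"
      by blast
    then have "axis k 1 - axis l 1 \<in> span ?F \<or> axis l 1 - axis k 1 \<in> span ?F"
      using span_base by blast
    then have "axis k 1 - axis l 1 \<in> span ?F"
      using span_neg[of "axis l 1 - axis k 1" ?F] by auto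
    moreover from this have "axis l 1 - axis k 1 \<in> span ?F"
      using span_neg by force
    ultimately show ?thesis
      using kl(1) by (auto simp: doubleton_eq_iff)
  qed
  have path: "axis v 1 - axis u 1 \<in> span ?F" for u v :: 'n
  proof (rule connected_graph_invariant[OF H(1), of u v])
    fix x y assume "{x, y} \<in> edges H" "axis x 1 - axis u 1 \<in> span ?F"
    then show "axis y 1 - axis u 1 \<in> span ?F"
      using span_add[OF edge[of x y]] by force
  qed (simp_all add: H(2) span_zero)
  then have "nabla G \<subseteq> span ?F"
    unfolding nabla_eq by blast
  then have "span ?F = span (nabla G)"
    by (metis Int_lower1 span_minimal span_mono subset_antisym subspace_span)
  moreover have "span ?Q = span (nabla G)"
    unfolding adjacency_polytope_def
    by (metis convex_hull_subset_span hull_subset span_minimal span_mono subset_antisym subspace_span)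
  ultimately have "dim ?Q = dim ?F"
    by (metis dim_span)
  also have "int (dim ?F) = aff_dim (insert 0 ?F)"
    by (rule aff_dim_insert_0[symmetric])
  also have "\<dots> \<le> aff_dim ?F + 1"
    by (simp add: aff_dim_insert)
  also have "aff_dim ?F \<le> aff_dim P"
    by (rule aff_dim_subset) simp
  finally have "int (dim ?Q) \<le> aff_dim P + 1"
    by simp
  moreover have "nabla G \<noteq> {}"
    using ne(1) by blast
  ultimately have "aff_dim ?Q \<le> aff_dim P + 1"
    by (simp add: aff_dim_adjacency_polytope)
  moreover have "aff_dim P < aff_dim ?Q"
    using face_of_aff_dim_lt[OF Qconv face] PQ by blast
  ultimately have "P facet_of ?Q"
    using face ne(1) by (auto simp: facet_of_def)
  then show ?thesis
    unfolding facet_subgraph_def nabla_facet_def using HF by blast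
qed

theorem mainTheorem1:
  fixes G :: "'n::finite ugraph"
  assumes "simple_graph G"
    and "verts G = UNIV"
    and "connected_graph G"
    and "edges G \<noteq> {}"
  shows "(\<forall>H. subgraph H G \<and> connected_graph H \<and> edges H \<noteq> {} \<longrightarrow>
            (face_subgraph H G \<longleftrightarrow> maximal_bipartite_subgraph H (induced_subgraph G (verts H)))) \<and>
         (\<forall>H. subgraph H G \<longrightarrow> (facet_subgraph H G \<longleftrightarrow> maximal_bipartite_subgraph H G))"
proof (intro conjI allI impI)
  show "face_subgraph H G \<longleftrightarrow> maximal_bipartite_subgraph H (induced_subgraph G (verts H))"
    if "subgraph H G \<and> connected_graph H \<and> edges H \<noteq> {}" for H
    using that face_subgraph_maximal_bipartite maximal_bipartite_face_subgraph assms(1) by blast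
next
  fix H assume sub: "subgraph H G"
  \<comment> \<open>For spanning \<open>H\<close> the induced subgraph is \<open>G\<close> itself,
    so the facet statement reduces to the arguments for faces.\<close>
  have ind: "induced_subgraph G UNIV = G"
    using assms(2) by (rule induced_subgraph_UNIV)
  show "facet_subgraph H G \<longleftrightarrow> maximal_bipartite_subgraph H G"
  proof
    assume "facet_subgraph H G"
    then have "face_subgraph H G" "connected_graph H" "verts H = UNIV"
      using facet_subgraph_connected assms by blast+
    then show "maximal_bipartite_subgraph H G"
      using face_subgraph_maximal_bipartite[OF assms(1) sub] ind by simp
  next
    assume max: "maximal_bipartite_subgraph H G"
    obtain A B where "verts H = verts G" and con: "connected_graph H"
      using maximal_bipartite_cut[OF assms(1,3) max] by metis
    then have vH: "verts H = UNIV"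
      using assms(2) by simp
    \<comment> \<open>An edge of \<open>G\<close> gives two distinct vertices, so the connected
      spanning \<open>H\<close> has an edge.\<close>
    obtain i j :: 'n where "i \<noteq> j"
      using assms(1,4) simple_graph_edgeE[of G] by (metis all_not_in_conv)
    then have "edges H \<noteq> {}"
      using connected_graph_exits[OF con, of i "{i}" j] vH by auto
    then have "face_subgraph H G"
      using maximal_bipartite_face_subgraph[OF assms(1) sub con] max ind vH by simp
    then show "facet_subgraph H G"
      using connected_face_subgraph_facet assms(1) con vH by blast
  qed
qed

end
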